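(* Let $(P,\le,{}',0,1)$ be a Boolean poset, $a,b\in P$ and $\Theta$ a congruence on $(P,\le,{}',0,1)$. Then: (i) if $(a,b)\in\Theta$ then $\operatorname{Min}U(a,b')\cap[1]\Theta\ne\emptyset$; (ii) if $a\le b$ and $LU(a,b')\cap[1]\Theta\ne\emptyset$ then $(a,b)\in\Theta$; (iii) if $a\le b$ and the supremum $a\vee b'$ exists, then $(a,b)\in\Theta$ if and only if $a\vee b'\in[1]\Theta$.
   Context: For a poset $(P,\le)$ and $A\subseteq P$ let $L(A)=\{x\mid x\le y\ \forall y\in A\}$, $U(A)=\{x\mid y\le x\ \forall y\in A\}$; write $L(x,y)=L(\{x,y\})$, $U(x,y)$, $L(A,z)=L(A\cup\{z\})$, $LU(x,y)=L(U(x,y))$, etc.; $\operatorname{Max}A$, $\operatorname{Min}A$ are the sets of maximal, minimal elements. A poset is distributive if $L(U(x,y),z)=LU(L(x,z),L(y,z))$ for all $x,y,z$. A complementation on a bounded poset $(P,\le,0,1)$ is a unary operation $'$ with $U(x,x')=\{1\}$ and $L(x,x')=\{0\}$; a Boolean poset is a distributive bounded poset with a complementation. A binary relation $R$ is compatible with a map $Q\colon P^2\to2^P$ if whenever $(a_1,b_1),(a_2,b_2)\in R$ there exist $a\in Q(a_1,a_2)$, $b\in Q(b_1,b_2)$ with $(a,b)\in R$. A congruence on a Boolean poset is an equivalence relation $\Theta$ compatible with $(x,y)\mapsto\operatorname{Max}L(x,y)$, $(x,y)\mapsto\operatorname{Min}U(x,y)$ and $'$ (i.e. $(a,b)\in\Theta\Rightarrow(a',b')\in\Theta$);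 $[1]\Theta$ is the class of $1$. *)

theory Defs
  imports "HOL-Library.Lub_Glb"
begin

(* The underlying set of a poset is a whole type of class order; in a bounded
   poset the constants 0 and 1 are bot and top. *)

definition lower_cone :: "'a::order set \<Rightarrow> 'a set" where
  "lower_cone A = {x. \<forall>y\<in>A. x \<le> y}"

definition upper_cone :: "'a::order set \<Rightarrow> 'a set" where
  "upper_cone A = {x. \<forall>y\<in>A. y \<le> x}"

definition maximal_elems :: "'a::order set \<Rightarrow> 'a set" where
  "maximal_elems A = {x\<in>A. \<not> (\<exists>y\<in>A. x < y)}"

definition minimal_elems :: "'a::order set \<Rightarrow> 'a set" where
  "minimal_elems A = {x\<in>A. \<not> (\<exists>y\<in>A. y < x)}"

(* The type argument only selects the order, which is fixed by the class. *)
definition distributive_poset :: "'a::order itself \<Rightarrow> bool" where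
  "distributive_poset _ \<longleftrightarrow>
     (\<forall>x y z :: 'a. lower_cone (upper_cone {x, y} \<union> {z}) =
        lower_cone (upper_cone (lower_cone {x, z} \<union> lower_cone {y, z})))"

definition complementation :: "('a::{order_bot,order_top} \<Rightarrow> 'a) \<Rightarrow> bool" where
  "complementation c \<longleftrightarrow>
     (\<forall>x. upper_cone {x, c x} = {top} \<and> lower_cone {x, c x} = {bot})"

definition boolean_poset :: "('a::{order_bot,order_top} \<Rightarrow> 'a) \<Rightarrow> bool" where
  "boolean_poset c \<longleftrightarrow> distributive_poset TYPE('a) \<and> complementation c"

definition compatible_with :: "('a \<times> 'a) set \<Rightarrow> ('a \<Rightarrow> 'a \<Rightarrow> 'a set) \<Rightarrow> bool" where
  "compatible_with R Q \<longleftrightarrow>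
     (\<forall>a1 b1 a2 b2. (a1, b1) \<in> R \<longrightarrow> (a2, b2) \<in> R \<longrightarrow>
        (\<exists>a\<in>Q a1 a2. \<exists>b\<in>Q b1 b2. (a, b) \<in> R))"

definition boolean_poset_congruence ::
    "('a::{order_bot,order_top} \<Rightarrow> 'a) \<Rightarrow> ('a \<times> 'a) set \<Rightarrow> bool" where
  "boolean_poset_congruence c \<Theta> \<longleftrightarrow>
     equiv UNIV \<Theta> \<and>
     compatible_with \<Theta> (\<lambda>x y. maximal_elems (lower_cone {x, y})) \<and>
     compatible_with \<Theta> (\<lambda>x y. minimal_elems (upper_cone {x, y})) \<and>
     (\<forall>a b. (a, b) \<in> \<Theta> \<longrightarrow> (c a, c b) \<in> \<Theta>)"

end

theory Submission
  imports Defs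
begin

text \<open>
  Part (i) joins the pair (a, b) with (b', b'), since Min U(b, b') = {1}. For part (ii), meeting
  the pair (e, 1) with (b, b), where e lies in LU(a, b'), gives some x below e and b with x related
  to b; distributivity gives L(U(a, b'), b) = L(a) when a is below b, so x is below a, and convexity
  of congruence classes finishes. If a and b' have a supremum s, then Min U(a, b') = {s} and s lies
  in LU(a, b'), so part (iii) is a special case of (i) and (ii).
\<close>

text \<open>For comparable elements the cone is principal, so its extremal set is a singleton.
  Compatibility only asserts that some related representatives exist; this lemma and its dual pin
  them down.\<close>

lemma maximal_elems_lower_cone_pair:
  fixes x y :: "'a::order"
  assumes "x \<le> y"
  shows "maximal_elems (lower_cone {y, x}) = {x}"
  using assms by (force simp: maximal_elems_def lower_cone_def order.order_iff_strict)

lemma minimal_elems_upper_cone_pair: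
  fixes x y :: "'a::order"
  assumes "x \<le> y"
  shows "minimal_elems (upper_cone {x, y}) = {y}"
  using assms by (force simp: minimal_elems_def upper_cone_def order.order_iff_strict)

text \<open>Turns a supremum into a principal filter, from which both Min U and LU can be read
  off.\<close>

lemma upper_cone_eq_if_isLub:
  fixes s :: "'a::order"
  assumes "isLub UNIV A s"
  shows "upper_cone A = {s..}"
  using assms
  by (force simp: upper_cone_def isLub_def leastP_def isUb_def setle_def setge_def)

text \<open>Distributivity splits the left side into LU of the union of L(a, b) and L(b', b). The
  second set is {0} and imposes no upper bound, while the first is L(a) because a is below
  b.\<close>

lemma boolean_poset_lower_cone_upper_cone_compl:
  fixes c :: "'a::{order_bot,order_top} \<Rightarrow> 'a"
  assumes "boolean_poset c" and "a \<le> b"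
  shows "lower_cone (upper_cone {a, c b} \<union> {b}) = {..a}"
proof -
  have "lower_cone {c b, b} = {bot}"
    using assms(1) by (simp add: boolean_poset_def complementation_def insert_commute)
  moreover have "lower_cone {a, b} = {..a}"
    using assms(2) by (auto simp: lower_cone_def)
  moreover have "lower_cone (upper_cone {a, c b} \<union> {b}) =
      lower_cone (upper_cone (lower_cone {a, b} \<union> lower_cone {c b, b}))"
    using assms(1) by (simp add: boolean_poset_def distributive_poset_def)
  moreover have "upper_cone ({..a} \<union> {bot}) = {a..}"
    by (auto simp: upper_cone_def)
  moreover have "lower_cone {a..} = {..a}"
    by (auto simp: lower_cone_def)
  ultimately show ?thesis by simp
qed

text \<open>Joining (x, b) with (a, a) leaves no choice of representatives: Min U(x, a) = {a} and
  Min U(b, a) = {b}.\<close>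

lemma boolean_poset_congruence_convex:
  assumes "boolean_poset_congruence c \<Theta>" and "(x, b) \<in> \<Theta>" and "x \<le> a" and "a \<le> b"
  shows "(a, b) \<in> \<Theta>"
proof -
  have "(a, a) \<in> \<Theta>"
    using assms(1) by (simp add: boolean_poset_congruence_def equiv_def refl_on_def)
  then obtain u v where "u \<in> minimal_elems (upper_cone {x, a})"
      "v \<in> minimal_elems (upper_cone {b, a})" "(u, v) \<in> \<Theta>"
    using assms(1,2) unfolding boolean_poset_congruence_def compatible_with_def by blast
  then show ?thesis
    using minimal_elems_upper_cone_pair[OF assms(3)] minimal_elems_upper_cone_pair[OF assms(4)]
    by (simp add: insert_commute)
qed

lemma boolean_poset_congruence_min_upper_cone:
  assumes "boolean_poset c" and "boolean_poset_congruence c \<Theta>" and "(a, b) \<in> \<Theta>"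
  shows "minimal_elems (upper_cone {a, c b}) \<inter> \<Theta> `` {top} \<noteq> {}"
proof -
  have eq: "equiv UNIV \<Theta>"
    using assms(2) by (simp add: boolean_poset_congruence_def)
  then have "(c b, c b) \<in> \<Theta>"
    by (simp add: equiv_def refl_on_def)
  \<comment> \<open>An upper cone in an arbitrary poset may lack minimal elements; here
    compatibility itself supplies \<open>u\<close>.\<close>
  then obtain u v where uv: "u \<in> minimal_elems (upper_cone {a, c b})"
      "v \<in> minimal_elems (upper_cone {b, c b})" "(u, v) \<in> \<Theta>"
    using assms(2,3) unfolding boolean_poset_congruence_def compatible_with_def by blast
  have "upper_cone {b, c b} = {top}"
    using assms(1) by (simp add: boolean_poset_def complementation_def)
  then have "v = top"
    using uv(2) by (simp add: minimal_elems_def)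
  then have "(top, u) \<in> \<Theta>"
    using uv(3) eq by (blast elim: equivE dest: symD)
  then show ?thesis using uv(1) by blast
qed

lemma boolean_poset_congruence_if_top_class:
  assumes "boolean_poset c" and "boolean_poset_congruence c \<Theta>" and "a \<le> b"
    and "e \<in> lower_cone (upper_cone {a, c b})" and "(top, e) \<in> \<Theta>"
  shows "(a, b) \<in> \<Theta>"
proof -
  have eq: "equiv UNIV \<Theta>"
    using assms(2) by (simp add: boolean_poset_congruence_def)
  then have "(e, top) \<in> \<Theta>" "(b, b) \<in> \<Theta>"
    using assms(5) by (auto elim: equivE dest: symD simp: refl_on_def)
  then obtain x v where xv: "x \<in> maximal_elems (lower_cone {e, b})"
      "v \<in> maximal_elems (lower_cone {top, b})" "(x, v) \<in> \<Theta>"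
    using assms(2) unfolding boolean_poset_congruence_def compatible_with_def by blast
  have "v = b"
    using xv(2) maximal_elems_lower_cone_pair[OF top_greatest[of b]] by simp
  moreover have "x \<le> e" "x \<le> b"
    using xv(1) by (auto simp: maximal_elems_def lower_cone_def)
  \<comment> \<open>LU(a, b') is a down-set, so it contains \<open>x\<close> along with
    \<open>e\<close>.\<close>
  then have "x \<in> lower_cone (upper_cone {a, c b} \<union> {b})"
    using assms(4) by (auto simp: lower_cone_def intro: order_trans)
  then have "x \<le> a"
    using boolean_poset_lower_cone_upper_cone_compl[OF assms(1,3)] by simp
  ultimately show ?thesis
    using boolean_poset_congruence_convex[OF assms(2) _ _ assms(3)] xv(3) by blast
qed

theorem theorem5p7:
  fixes c :: "'a::{order_bot,order_top} \<Rightarrow> 'a"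
    and a b :: 'a
    and \<Theta> :: "('a \<times> 'a) set"
  assumes "boolean_poset c"
    and "boolean_poset_congruence c \<Theta>"
  shows "((a, b) \<in> \<Theta> \<longrightarrow> minimal_elems (upper_cone {a, c b}) \<inter> \<Theta> `` {top} \<noteq> {})
    \<and> (a \<le> b \<and> lower_cone (upper_cone {a, c b}) \<inter> \<Theta> `` {top} \<noteq> {} \<longrightarrow> (a, b) \<in> \<Theta>)
    \<and> (\<forall>s. a \<le> b \<and> isLub UNIV {a, c b} s \<longrightarrow> ((a, b) \<in> \<Theta> \<longleftrightarrow> s \<in> \<Theta> `` {top}))"
proof (intro conjI allI impI)
  assume "(a, b) \<in> \<Theta>"
  then show "minimal_elems (upper_cone {a, c b}) \<inter> \<Theta> `` {top} \<noteq> {}"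
    by (rule boolean_poset_congruence_min_upper_cone[OF assms])
next
  assume "a \<le> b \<and> lower_cone (upper_cone {a, c b}) \<inter> \<Theta> `` {top} \<noteq> {}"
  then show "(a, b) \<in> \<Theta>"
    using boolean_poset_congruence_if_top_class[OF assms] by blast
next
  fix s
  assume s: "a \<le> b \<and> isLub UNIV {a, c b} s"
  then have U: "upper_cone {a, c b} = {s..}"
    by (simp add: upper_cone_eq_if_isLub)
  \<comment> \<open>As \<open>s\<close> is the only minimal upper bound, the nonempty intersection
    given by (i) forces \<open>s\<close> into the class of 1. Conversely \<open>s\<close> itself
    serves as the witness \<open>e\<close> for (ii).\<close>
  have "minimal_elems {s..} = {s}"
    by (force simp: minimal_elems_def order.order_iff_strict)
  moreover have "s \<in> lower_cone {s..}"
    by (simp add: lower_cone_def)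
  ultimately show "(a, b) \<in> \<Theta> \<longleftrightarrow> s \<in> \<Theta> `` {top}"
    using boolean_poset_congruence_min_upper_cone[OF assms, of a b]
      boolean_poset_congruence_if_top_class[OF assms, of a b s] s U
    by auto
qed

end
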